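(* Let $R := \mathbb{Z} + \mathbb{Z}x + x^2\mathbb{R}[x]$, the subring of $\mathbb{R}[x]$ consisting of all real polynomials whose coefficients of degree $0$ and degree $1$ are integers, and let $y$ be an algebraically independent variable over $R$. Then the polynomial extension $R[y]$ is not quasi-atomic.
   Context: For an integral domain $D$, an atom is a nonzero nonunit $a$ such that $a=bc$ with $b,c\in D$ implies that $b$ or $c$ is a unit. A nonzero element of $D$ is atomic if it is a unit or a product of finitely many atoms. $D$ is quasi-atomic if for each nonzero $b\in D$ there is a nonzero $a\in D$ such that $ab$ is atomic. *)

theory Defs
  imports Complex_Main "HOL-Computational_Algebra.Computational_Algebra"
begin

text \<open>
  Factorization notions in an integral domain, given as a type of class
  \<^class>\<open>idom\<close>. An atom is \<^const>\<open>irreducible\<close>: a nonzero nonunit \<open>a\<close> such that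
  \<open>a = b * c\<close> forces \<open>b\<close> or \<open>c\<close> to be a unit (\<open>dvd 1\<close>).
\<close>

definition atomic_element :: "'a::idom \<Rightarrow> bool" where
  "atomic_element a \<longleftrightarrow>
     a \<noteq> 0 \<and> (a dvd 1 \<or> (\<exists>A. (\<forall>p\<in>#A. irreducible p) \<and> a = prod_mset A))"

definition quasi_atomic :: "'a::idom itself \<Rightarrow> bool" where
  "quasi_atomic _ \<longleftrightarrow> (\<forall>b::'a. b \<noteq> 0 \<longrightarrow> (\<exists>a::'a. a \<noteq> 0 \<and> atomic_element (a * b)))"

text \<open>
  The domain \<open>R\<close> is turned into a type, with the ring operations inherited from
  \<^typ>\<open>real poly\<close>, so that \<open>R[y]\<close> is the library's polynomial ring over that type.
\<close>

typedef R = "{f :: real poly. coeff f 0 \<in> \<int> \<and> coeff f 1 \<in> \<int>}"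
  morphisms real_poly_of_R R_of_real_poly
  by (rule exI[of _ 0]) simp

setup_lifting type_definition_R

instantiation R :: idom
begin

lift_definition zero_R :: R is 0 by simp

lift_definition one_R :: R is 1 by simp

lift_definition plus_R :: "R \<Rightarrow> R \<Rightarrow> R" is "(+)" by simp

lift_definition minus_R :: "R \<Rightarrow> R \<Rightarrow> R" is "(-)" by simp

lift_definition uminus_R :: "R \<Rightarrow> R" is uminus by simp

lift_definition times_R :: "R \<Rightarrow> R \<Rightarrow> R" is "(*)"
  by (simp add: coeff_mult)

instance
  by standard (transfer; simp add: algebra_simps)+

end

lemma range_real_poly_of_R:
  "range real_poly_of_R =
     {[:of_int m:] + [:of_int n:] * [:0, 1:] + [:0, 1:] ^ 2 * g | m n g. True}"
proof -
  have "\<exists>m n g. f = [:of_int m:] + [:of_int n:] * [:0, 1:] + [:0, 1:] ^ 2 * g"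
    if f: "coeff f 0 \<in> \<int>" "coeff f 1 \<in> \<int>" for f :: "real poly"
  proof -
    obtain a b g where fe: "f = pCons a (pCons b g)"
      by (metis pCons_cases)
    from f obtain m n where "a = of_int m" "b = of_int n"
      by (auto simp: fe elim!: Ints_cases)
    then have "f = [:of_int m:] + [:of_int n:] * [:0, 1:] + [:0, 1:] ^ 2 * g"
      by (simp add: fe power2_eq_square)
    then show ?thesis by blast
  qed
  moreover have "range real_poly_of_R = {f. coeff f 0 \<in> \<int> \<and> coeff f 1 \<in> \<int>}"
    using type_definition.Rep_range[OF type_definition_R] .
  ultimately show ?thesis
    by (auto simp: power2_eq_square coeff_pCons)
qed

end

theory Submission
  imports Defs "HOL-Analysis.Continuum_Not_Denumerable"
begin

text \<open>
  Let \<open>t\<close> be a transcendental real number. If an element of \<open>R[y]\<close> vanishes at \<open>y = t\<close>, then so do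
  its components of degree 0 and 1 in \<open>x\<close>. These are integer polynomials in \<open>y\<close>, hence zero, and the
  element lies in \<open>x\<^sup>2 \<real>[x, y]\<close>. It is therefore twice another element of \<open>R[y]\<close>, and not an atom.
  Since evaluation at \<open>y = t\<close> is a homomorphism into the domain \<open>\<real>[x]\<close>, no multiple of
  \<open>x\<^sup>2 (y - t)\<close> is a unit or a product of atoms.
\<close>

text \<open>Every algebraic number is a root of a nonzero polynomial given by a list of integers,
  and there are only countably many such lists. The zero polynomial contributes the empty set, so
  every set in the union is finite.\<close>

lemma countable_algebraic: "countable {x :: 'a :: field_char_0. algebraic x}"
proof -
  have "{x :: 'a. algebraic x} \<subseteq>
      (\<Union>as\<in>lists \<int>. if Poly as = 0 then {} else {x. poly (Poly as) x = 0})" (is "_ \<subseteq> ?B")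
  proof
    fix x :: 'a assume "x \<in> {x. algebraic x}"
    then obtain p :: "'a poly" where "\<And>i. coeff p i \<in> \<int>" "p \<noteq> 0" "poly p x = 0"
      unfolding algebraic_def by blast
    moreover from this have "coeffs p \<in> lists \<int>" by (auto simp: coeffs_def)
    ultimately show "x \<in> ?B" by (intro UN_I[of "coeffs p"]) auto
  qed
  moreover have "countable ?B"
    by (intro countable_UN countable_lists)
      (auto simp: Ints_def intro!: countable_finite poly_roots_finite)
  ultimately show ?thesis by (rule countable_subset)
qed

lemma ex_transcendental: "\<exists>t :: real. \<not> algebraic t"
  using countable_algebraic[where 'a = real] uncountable_UNIV_real
  by (metis UNIV_eq_I mem_Collect_eq)

text \<open>The number \<open>t\<close> need not be a constant of R, so the coefficients are first
  embedded in \<real>[x]. Then \<open>[:t:]\<close> replaces y, while x remains a variable.\<close>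

definition eval_at :: "real \<Rightarrow> R poly \<Rightarrow> real poly" where
  "eval_at t f = poly (map_poly real_poly_of_R f) [:t:]"

lemma real_poly_of_R_sum: "real_poly_of_R (sum f A) = (\<Sum>a\<in>A. real_poly_of_R (f a))"
  by (induction A rule: infinite_finite_induct) (simp_all add: zero_R.rep_eq plus_R.rep_eq)

lemma map_real_poly_of_R_mult:
  "map_poly real_poly_of_R (f * g) = map_poly real_poly_of_R f * map_poly real_poly_of_R g"
  by (rule poly_eqI)
    (simp add: coeff_map_poly zero_R.rep_eq coeff_mult real_poly_of_R_sum times_R.rep_eq)

lemma eval_at_mult: "eval_at t (f * g) = eval_at t f * eval_at t g"
  by (simp add: eval_at_def map_real_poly_of_R_mult)

lemma eval_at_1: "eval_at t 1 = 1"
  by (simp add: eval_at_def map_poly_1' one_R.rep_eq)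

lemma eval_at_add: "eval_at t (f + g) = eval_at t f + eval_at t g"
proof -
  have "map_poly real_poly_of_R (f + g) = map_poly real_poly_of_R f + map_poly real_poly_of_R g"
    by (rule poly_eqI) (simp add: coeff_map_poly zero_R.rep_eq plus_R.rep_eq)
  then show ?thesis by (simp add: eval_at_def)
qed

lemma eval_at_dvd_1:
  assumes "f dvd 1" shows "eval_at t f \<noteq> 0"
  using assms by (metis dvdE eval_at_1 eval_at_mult mult_zero_left zero_neq_one)

lemma eval_at_prod_mset_eq_0:
  "eval_at t (prod_mset A) = 0 \<Longrightarrow> \<exists>p\<in>#A. eval_at t p = 0"
  by (induction A) (auto simp: eval_at_1 eval_at_mult)

text \<open>For \<open>k\<close> equal to 0 or 1 the right-hand side is an integer polynomial in
  \<open>t\<close>, to which transcendence applies.\<close>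

lemma coeff_eval_at:
  "coeff (eval_at t f) k =
     (\<Sum>i\<le>degree f. coeff (real_poly_of_R (coeff f i)) k * t ^ i)"
proof -
  have "degree (map_poly real_poly_of_R f) = degree f"
    by (rule degree_map_poly) (simp add: real_poly_of_R_inject flip: zero_R.rep_eq)
  then show ?thesis
    by (simp add: eval_at_def poly_altdef coeff_map_poly zero_R.rep_eq poly_const_pow coeff_sum
        mult.commute)
qed

lemma transcendental_int_comb:
  fixes c :: "nat \<Rightarrow> 'a :: field_char_0"
  assumes "\<not> algebraic t" "\<And>i. c i \<in> \<int>" "(\<Sum>i\<le>n. c i * t ^ i) = 0" "i \<le> n"
  shows "c i = 0"
proof -
  define p where "p = (\<Sum>i\<le>n. monom (c i) i)"
  have coeff_p: "coeff p k = (if k \<le> n then c k else 0)" for k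
    by (simp add: p_def coeff_sum)
  have "poly p t = 0"
    using assms(3) by (simp add: p_def poly_sum poly_monom)
  moreover have "coeff p k \<in> \<int>" for k
    using assms(2) by (simp add: coeff_p)
  ultimately have "p = 0"
    using assms(1) by (auto simp: algebraic_def)
  then show ?thesis using coeff_p[of i] assms(4) by simp
qed

lemma coeff_eq_0_of_eval_at_eq_0:
  assumes t: "\<not> algebraic t" and f: "eval_at t f = 0" and k: "k = 0 \<or> k = 1"
  shows "coeff (real_poly_of_R (coeff f i)) k = 0"
proof (cases "i \<le> degree f")
  case True
  show ?thesis
  proof (rule transcendental_int_comb[OF t _ _ True])
    show "coeff (real_poly_of_R (coeff f i)) k \<in> \<int>" for i
      using real_poly_of_R[of "coeff f i"] k by auto
    show "(\<Sum>i\<le>degree f. coeff (real_poly_of_R (coeff f i)) k * t ^ i) = 0"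
      using f by (simp flip: coeff_eval_at)
  qed
next
  case False
  then show ?thesis by (simp add: coeff_eq_0 zero_R.rep_eq)
qed

lemma coeff_2_mult:
  "real_poly_of_R (coeff (2 * f) i) = 2 * real_poly_of_R (coeff f i)"
  by (simp only: mult_2 coeff_add plus_R.rep_eq)

lemma ex_half_of_eval_at_eq_0:
  assumes "\<not> algebraic t" "eval_at t f = 0"
  shows "\<exists>g. f = 2 * g"
proof -
  \<comment> \<open>Halving can lead out of R. Here \<open>h\<close> is applied only to coefficients
    whose terms of degree 0 and 1 in x vanish; the higher terms may be any reals.\<close>
  define h where "h a = R_of_real_poly (smult (1/2) (real_poly_of_R a))" for a
  define g where "g = map_poly h f"
  have h: "real_poly_of_R (h (coeff f i)) = smult (1/2) (real_poly_of_R (coeff f i))" for i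
    unfolding h_def using coeff_eq_0_of_eval_at_eq_0[OF assms, of _ i]
    by (subst R_of_real_poly_inverse) auto
  have h0: "h 0 = 0"
    by (simp add: h_def zero_R.rep_eq) (simp add: zero_R_def)
  have "real_poly_of_R (coeff (2 * g) i) = real_poly_of_R (coeff f i)" for i
    unfolding coeff_2_mult by (simp add: g_def coeff_map_poly h0 h numeral_poly)
  then have "f = 2 * g" by (intro poly_eqI) (simp only: real_poly_of_R_inject)
  then show ?thesis ..
qed

text \<open>If 2 had an inverse, comparing the terms free of x and y would make 1 an even
  integer.\<close>

lemma two_not_dvd_1: "\<not> (2 :: R poly) dvd 1"
proof
  assume "(2 :: R poly) dvd 1"
  then obtain g :: "R poly" where "1 = 2 * g" by (elim dvdE)
  then have "real_poly_of_R (coeff 1 0) = 2 * real_poly_of_R (coeff g 0)"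
    using coeff_2_mult by metis
  then have "coeff 1 0 = coeff (2 * real_poly_of_R (coeff g 0)) 0"
    by (simp add: one_R.rep_eq)
  then have "1 = 2 * coeff (real_poly_of_R (coeff g 0)) 0"
    by (simp add: numeral_poly)
  moreover obtain m where "coeff (real_poly_of_R (coeff g 0)) 0 = of_int m"
    using real_poly_of_R[of "coeff g 0"] by (auto elim: Ints_cases)
  ultimately have "(1::int) = 2 * m" by linarith
  then show False by presburger
qed

text \<open>If \<open>p\<close> vanished, it would be \<open>2 * g\<close>. Since 2 is not a unit,
  \<open>g\<close> would be one; but \<open>g\<close> vanishes at \<open>t\<close> as well, which no
  unit does.\<close>

lemma irreducible_eval_at_neq_0:
  assumes t: "\<not> algebraic t" and "irreducible p"
  shows "eval_at t p \<noteq> 0"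
proof
  assume p: "eval_at t p = 0"
  with t obtain g where g: "p = 2 * g" using ex_half_of_eval_at_eq_0 by blast
  then have "g dvd 1"
    using \<open>irreducible p\<close> two_not_dvd_1 by (auto dest: irreducibleD)
  moreover have "eval_at t g = 0"
    using p unfolding g mult_2 eval_at_add by (simp flip: mult_2)
  ultimately show False using eval_at_dvd_1 by blast
qed

theorem theorem4p1: "\<not> quasi_atomic TYPE(R poly)"
proof -
  obtain t :: real where t: "\<not> algebraic t" using ex_transcendental by blast
  \<comment> \<open>\<open>r s\<close> is s x^2, an element of R for every real
    \<open>s\<close>.\<close>
  define r where "r s = R_of_real_poly (monom s 2)" for s
  have r: "real_poly_of_R (r s) = monom s 2" for s
    unfolding r_def by (subst R_of_real_poly_inverse) auto
  \<comment> \<open>This is x^2 (y - t), expanded because y - t itself is not in R[y].\<close>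
  define b where "b = [:r (- t), r 1:]"
  have "r 1 \<noteq> 0" by (simp add: r zero_R.rep_eq flip: real_poly_of_R_inject)
  then have "b \<noteq> 0" by (simp add: b_def)
  have b: "eval_at t b = 0"
    using \<open>r 1 \<noteq> 0\<close>
    by (simp add: eval_at_def b_def map_poly_pCons r zero_R.rep_eq smult_monom add_monom)
  have "\<not> atomic_element (a * b)" for a
  proof
    assume "atomic_element (a * b)"
    moreover have "eval_at t (a * b) = 0" by (simp add: eval_at_mult b)
    ultimately show False
      using eval_at_dvd_1 eval_at_prod_mset_eq_0 irreducible_eval_at_neq_0[OF t]
      unfolding atomic_element_def by metis
  qed
  with \<open>b \<noteq> 0\<close> show ?thesis unfolding quasi_atomic_def by blast
qed

end
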